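(* Let $N$ be the free (right) Novikov algebra over $\mathbb{Q}$ with generators $a^{[1]},\dots,a^{[i]}$. Then in $\mathbb{Q}[N]$: $$a^{[i]}\ast\cdots\ast a^{[1]}=\sum_{k=1}^i\ \sum_{I_1\sqcup_<\cdots\sqcup_< I_k=[i]}\left(\sum_{w\in K_{|I_1|}}c_w\,a^{[x^1_1]}_{w_1-1}\cdots a^{[x^1_{|I_1|}]}_{w_{|I_1|}-1}\right)\odot\cdots\odot\left(\sum_{z\in K_{|I_k|}}c_z\,a^{[x^k_1]}_{z_1-1}\cdots a^{[x^k_{|I_k|}]}_{z_{|I_k|}-1}\right),$$ where $I_j=\{x^j_1<\cdots<x^j_{|I_j|}\}$ and $I_1\sqcup_<\cdots\sqcup_<I_k=[i]$ means that the sum runs over partitions of the set $[i]=\{1,\dots,i\}$ into nonempty blocks, ordered so that $\min(I_1)<\cdots<\min(I_k)$.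
   Context: A (right) Novikov algebra is a vector space with a bilinear product $\triangleleft$ such that $(x\triangleleft y)\triangleleft z-x\triangleleft(y\triangleleft z)$ is symmetric in $y,z$ (right pre-Lie) and $a\triangleleft(b\triangleleft c)=b\triangleleft(a\triangleleft c)$. Realization of the free Novikov algebra $N$: let $\mathcal A$ be the polynomial algebra over $\mathbb{Q}$ in variables $a^{[r]}_j$, $1\le r\le i$, $j\ge-1$, with derivation $\partial(a^{[r]}_j)=a^{[r]}_{j+1}$ and product $u\triangleleft v:=\partial(u)v$. Then $N\subset\mathcal A$ is the span of the monomials whose weight (sum of the lower indices of the variables, with multiplicity) is $-1$, and the generator $a^{[r]}$ is $a^{[r]}_{-1}$. Its symmetric braces are $u\{v_1\cdots v_n\}=v_1\cdots v_n\,\partial^n(u)$. $\mathbb{Q}[N]$ is the symmetric algebra of the vector space $N$, with product denoted $\odot$ (while juxtaposition inside the parentheses of the formula is the product of $\mathcal A$). It carries the associative product (making it an enveloping algebra of $N$) $$(w_1\odot\cdots\odot w_n)\ast(z_1\odot\cdots\odot z_m)=\sum_{I_1\sqcup\cdots\sqcup I_{n+1}=[m]}w_1\{z_{I_1}\}\odot\cdots\odot w_n\{z_{I_n}\}\odot z_{I_{n+1}},$$ where blocks may be empty, $z_I=\bigodot_{i\in I}z_i$ and $w\{1\}=w$. For $m\ge1$, $K_m$ is the set of words $w=w_1\cdots w_m$ in nonnegative integers with $w_1+\cdots+w_j\le j-1$ for $1\le j<m$ and $w_1+\cdots+w_m=m-1$. For $w\in K_m$, set $d_j:=j-1-w_1-\cdots-w_j$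 and $c_w:=\prod_{j=1}^m\binom{d_j+w_j}{w_j}$. *)

theory Defs
  imports
    Complex_Main
    "HOL-Library.Poly_Mapping"
    "HOL-Library.Multiset"
    "HOL-Library.FuncSet"
    "HOL-Library.Disjoint_Sets"
    "HOL-Combinatorics.Permutations"
begin

section \<open>Polynomial algebras over the rationals\<close>

text \<open>
  The commutative polynomial algebra over the rationals in the variables \<open>'v\<close>: the monoid algebra
  of the free commutative monoid \<open>'v multiset\<close>. Up to isomorphism it is also the symmetric algebra
  of the vector space with basis \<open>'v\<close>; the inclusion of that vector space is \<open>sym_inj\<close> below.
\<close>

type_synonym 'v pol = "'v multiset \<Rightarrow>\<^sub>0 rat"

definition mon :: "'b \<Rightarrow> ('b \<Rightarrow>\<^sub>0 rat)" where
  "mon b = Poly_Mapping.single b 1"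

definition rscale :: "rat \<Rightarrow> ('b::comm_monoid_add \<Rightarrow>\<^sub>0 rat) \<Rightarrow> ('b \<Rightarrow>\<^sub>0 rat)" where
  "rscale c p = Poly_Mapping.single 0 c * p"

definition lin_ext :: "('b \<Rightarrow> ('c::comm_monoid_add \<Rightarrow>\<^sub>0 rat)) \<Rightarrow> ('b \<Rightarrow>\<^sub>0 rat) \<Rightarrow> ('c \<Rightarrow>\<^sub>0 rat)" where
  "lin_ext f p = (\<Sum>b\<in>Poly_Mapping.keys p. rscale (Poly_Mapping.lookup p b) (f b))"

definition sym_inj :: "('b \<Rightarrow>\<^sub>0 rat) \<Rightarrow> 'b pol" where
  "sym_inj = lin_ext (\<lambda>b. mon {#b#})"

lemma lookup_rscale: "Poly_Mapping.lookup (rscale c p) b = c * Poly_Mapping.lookup p b"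
proof -
  have "rscale c p = Poly_Mapping.map ((*) c) p"
    unfolding rscale_def by (simp add: mult_map_scale_conv_mult)
  then show ?thesis by (simp add: Poly_Mapping.map.rep_eq when_def)
qed

interpretation pol: vector_space rscale
  by unfold_locales (simp_all add: poly_mapping_eq_iff fun_eq_iff lookup_rscale lookup_add algebra_simps)

lemma keys_rscale: "Poly_Mapping.keys (rscale c p) \<subseteq> Poly_Mapping.keys p"
  by (auto simp: in_keys_iff lookup_rscale)

lemma lin_ext_superset:
  assumes "finite S" "Poly_Mapping.keys p \<subseteq> S"
  shows "lin_ext f p = (\<Sum>b\<in>S. rscale (Poly_Mapping.lookup p b) (f b))"
  unfolding lin_ext_def by (rule sum.mono_neutral_left) (use assms in \<open>auto simp: in_keys_iff\<close>)

lemma lin_ext_zero [simp]: "lin_ext f 0 = 0"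
  by (simp add: lin_ext_def)

lemma lin_ext_add: "lin_ext f (p + q) = lin_ext f p + lin_ext f q"
proof -
  let ?S = "Poly_Mapping.keys p \<union> Poly_Mapping.keys q"
  have "finite ?S" "Poly_Mapping.keys (p + q) \<subseteq> ?S" using keys_add[of p q] by auto
  then show ?thesis
    by (subst (1 2 3) lin_ext_superset[of ?S])
       (auto simp: lookup_add pol.scale_left_distrib sum.distrib)
qed

lemma lin_ext_rscale: "lin_ext f (rscale c p) = rscale c (lin_ext f p)"
  by (subst lin_ext_superset[OF _ keys_rscale])
     (simp_all add: lin_ext_def lookup_rscale pol.scale_sum_right)

lemma lin_ext_mon [simp]: "lin_ext f (mon b) = f b"
  by (simp add: lin_ext_def mon_def)

lemma pol_eq_sum_mon:
  fixes p :: "'b::comm_monoid_add \<Rightarrow>\<^sub>0 rat"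
  shows "p = (\<Sum>b\<in>Poly_Mapping.keys p. rscale (Poly_Mapping.lookup p b) (mon b))"
proof (rule poly_mapping_eqI)
  fix k
  show "Poly_Mapping.lookup p k
      = Poly_Mapping.lookup (\<Sum>b\<in>Poly_Mapping.keys p. rscale (Poly_Mapping.lookup p b) (mon b)) k"
    by (auto simp: lookup_sum lookup_rscale mon_def lookup_single when_def in_keys_iff
        if_distrib cong: if_cong)
qed

lemma pol_induct [case_names zero mon add scale]:
  fixes p :: "'b::comm_monoid_add \<Rightarrow>\<^sub>0 rat"
  assumes "P 0" "\<And>b. P (mon b)" "\<And>p q. P p \<Longrightarrow> P q \<Longrightarrow> P (p + q)" "\<And>c p. P p \<Longrightarrow> P (rscale c p)"
  shows "P p"
proof -
  have "P (\<Sum>b\<in>S. rscale (Poly_Mapping.lookup p b) (mon b))" if "finite S" for S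
    using that by induction (auto intro: assms)
  from this[of "Poly_Mapping.keys p"] show ?thesis
    using pol_eq_sum_mon[of p] by simp
qed

lemma mon_mult: "mon a * mon b = mon (a + b)"
  by (simp add: mon_def mult_single)

lemma mon_zero: "mon 0 = 1"
  by (simp add: mon_def)

lemma rscale_mult_left: "rscale c p * q = rscale c (p * q)"
  by (simp add: rscale_def mult.assoc)

lemma rscale_mult_right: "p * rscale c q = rscale c (p * q)"
  for p :: "'b::comm_monoid_add \<Rightarrow>\<^sub>0 rat"
  by (simp add: rscale_def mult.left_commute)

lemma sym_inj_mon [simp]: "sym_inj (mon b) = mon {#b#}"
  by (simp add: sym_inj_def)


section \<open>The differential polynomial algebra and the free Novikov algebra\<close>

text \<open>
  The pair \<open>(r, j)\<close> is the variable with upper index \<open>r\<close> and lower index \<open>j\<close>. The index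
  constraints on \<open>r\<close> and \<open>j\<close> are imposed by the carrier sets below; on all of \<open>dpol\<close>, the formulas
  for the derivation and for the products make sense and restrict to these carriers.
\<close>

type_synonym dpol = "(nat \<times> int) pol"

definition avar :: "nat \<Rightarrow> int \<Rightarrow> dpol" where
  "avar r j = mon {#(r, j)#}"

definition der :: "dpol \<Rightarrow> dpol" where
  "der = lin_ext (\<lambda>m. \<Sum>v\<in>#m. mon (m - {#v#} + {#(fst v, snd v + 1)#}))"

definition nov_prod :: "dpol \<Rightarrow> dpol \<Rightarrow> dpol" (infixl "\<lhd>" 70) where
  "u \<lhd> v = der u * v"

definition weight :: "(nat \<times> int) multiset \<Rightarrow> int" where
  "weight m = (\<Sum>v\<in>#m. snd v)"

definition dmonomials :: "nat \<Rightarrow> (nat \<times> int) multiset set" where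
  "dmonomials i = {m. \<forall>(r, j)\<in>#m. 1 \<le> r \<and> r \<le> i \<and> j \<ge> -1}"

definition dalgebra :: "nat \<Rightarrow> dpol set" where
  "dalgebra i = pol.span (mon ` dmonomials i)"

definition nov_monomials :: "nat \<Rightarrow> (nat \<times> int) multiset set" where
  "nov_monomials i = {m \<in> dmonomials i. weight m = -1}"

definition novikov :: "nat \<Rightarrow> dpol set" where
  "novikov i = pol.span (mon ` nov_monomials i)"

definition generator :: "nat \<Rightarrow> dpol" where
  "generator r = avar r (-1)"

definition brace :: "dpol \<Rightarrow> ('j \<Rightarrow> dpol) \<Rightarrow> 'j set \<Rightarrow> dpol" where
  "brace u v J = (\<Prod>j\<in>J. v j) * (der ^^ card J) u"


section \<open>The symmetric algebra of the Novikov algebra and its associative product\<close>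

text \<open>
  The symmetric algebra of all of \<open>dpol\<close> is \<open>spol\<close>; its commutative ring multiplication is the
  product \<open>\<odot>\<close>, and \<open>sym_inj\<close> includes \<open>dpol\<close> in it. Since \<open>novikov i\<close> has the basis
  \<open>nov_monomials i\<close>, its symmetric algebra is the subspace \<open>sym_novikov i\<close> of \<open>spol\<close>.
\<close>

type_synonym spol = "(nat \<times> int) multiset pol"

definition sym_novikov :: "nat \<Rightarrow> spol set" where
  "sym_novikov i = pol.span (mon ` {W. \<forall>m\<in>#W. m \<in> nov_monomials i})"

text \<open>
  Families \<open>I 0, \<dots>, I n\<close> of pairwise disjoint, possibly empty sets with union \<open>{0..<m}\<close>.
  Indices start at 0, so that \<open>I n\<close> is the last of the \<open>n + 1\<close> blocks.
\<close>

definition block_families :: "nat \<Rightarrow> nat \<Rightarrow> (nat \<Rightarrow> nat set) set" where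
  "block_families n m =
    {I \<in> {..n} \<rightarrow>\<^sub>E Pow {..<m}. disjoint_family_on I {..n} \<and> (\<Union>k\<le>n. I k) = {..<m}}"

definition star_list :: "dpol list \<Rightarrow> dpol list \<Rightarrow> spol" where
  "star_list ws zs =
    (\<Sum>I\<in>block_families (length ws) (length zs).
      (\<Prod>k<length ws. sym_inj (brace (ws ! k) ((!) zs) (I k))) *
      (\<Prod>j\<in>I (length ws). sym_inj (zs ! j)))"

text \<open>
  The bilinear extension of \<open>star_list\<close> from the basis of \<open>spol\<close>. The choice of enumerations of
  the multisets is immaterial, and the defining formula holds for arbitrary factors, see
  \<open>star_formula\<close>.
\<close>

definition star :: "spol \<Rightarrow> spol \<Rightarrow> spol" (infixr "\<star>" 70) where
  "P \<star> Q = lin_ext (\<lambda>W. lin_ext (\<lambda>Z.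
      star_list (map mon (SOME ws. mset ws = W)) (map mon (SOME zs. mset zs = Z))) Q) P"

text \<open>
  Iterated products, bracketed to the right; since \<open>\<star>\<close> is associative, this choice of bracketing
  is only a convention.
\<close>

fun star_prod :: "spol list \<Rightarrow> spol" where
  "star_prod [] = 1"
| "star_prod [P] = P"
| "star_prod (P # Q # Ps) = P \<star> star_prod (Q # Ps)"


section \<open>The index sets and coefficients of the formula\<close>

text \<open>
  The letter \<open>w\<^sub>j\<close> of a word is \<open>w ! (j - 1)\<close>. The subtractions on \<open>nat\<close> in \<open>words m\<close>, for
  \<open>m \<ge> 1\<close>, and in \<open>word_d w j\<close>, for \<open>w \<in> words m\<close> and \<open>1 \<le> j \<le> m\<close>, do not truncate.
\<close>

definition words :: "nat \<Rightarrow> nat list set" where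
  "words m = {w. length w = m \<and> (\<forall>j. 1 \<le> j \<and> j < m \<longrightarrow> sum_list (take j w) \<le> j - 1)
                 \<and> sum_list w = m - 1}"

definition word_d :: "nat list \<Rightarrow> nat \<Rightarrow> nat" where
  "word_d w j = j - 1 - sum_list (take j w)"

definition word_coeff :: "nat list \<Rightarrow> nat" where
  "word_coeff w = (\<Prod>j=1..length w. (word_d w j + w ! (j - 1)) choose (w ! (j - 1)))"

definition block_sum :: "nat set \<Rightarrow> dpol" where
  "block_sum I = (\<Sum>w\<in>words (card I). of_nat (word_coeff w) *
      (\<Prod>j=1..card I. avar (sorted_list_of_set I ! (j - 1)) (int (w ! (j - 1)) - 1)))"

definition ordered_partitions :: "nat \<Rightarrow> nat \<Rightarrow> nat set list set" where
  "ordered_partitions i k =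
    {Is. length Is = k \<and> partition_on {1..i} (set Is) \<and> sorted_wrt (<) (map Min Is)}"


section \<open>The Novikov identities\<close>

lemma der_add: "der (p + q) = der p + der q"
  by (simp add: der_def lin_ext_add)

lemma der_rscale: "der (rscale c p) = rscale c (der p)"
  by (simp add: der_def lin_ext_rscale)

lemma der_zero [simp]: "der 0 = 0"
  by (simp add: der_def)

lemma der_mon: "der (mon m) = (\<Sum>v\<in>#m. mon (m - {#v#} + {#(fst v, snd v + 1)#}))"
  by (simp add: der_def)

lemma der_avar: "der (avar r j) = avar r (j + 1)"
  by (simp add: avar_def der_mon)

lemma der_mult_mon: "der (mon m * mon n) = der (mon m) * mon n + mon m * der (mon n)"
proof -
  have "(\<Sum>v\<in>#m. mon (m + n - {#v#} + {#(fst v, snd v + 1)#}))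
      = (\<Sum>v\<in>#m. mon (m - {#v#} + {#(fst v, snd v + 1)#}) * mon n)"
    by (intro arg_cong[where f = sum_mset] image_mset_cong) (auto simp: mon_mult ac_simps)
  moreover have "(\<Sum>v\<in>#n. mon (m + n - {#v#} + {#(fst v, snd v + 1)#}))
      = (\<Sum>v\<in>#n. mon m * mon (n - {#v#} + {#(fst v, snd v + 1)#}))"
    by (intro arg_cong[where f = sum_mset] image_mset_cong) (auto simp: mon_mult ac_simps)
  ultimately show ?thesis
    by (simp add: mon_mult[of m n] der_mon sum_mset_distrib_left sum_mset_distrib_right)
qed

lemma der_mult: "der (p * q) = der p * q + p * der q"
proof (induction p rule: pol_induct)
  case (mon m)
  show ?case
    by (induction q rule: pol_induct)
       (simp_all add: der_mult_mon der_add der_rscale rscale_mult_right distrib_left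
          pol.scale_right_distrib ac_simps)
qed (simp_all add: der_add der_rscale rscale_mult_left rscale_mult_right distrib_left distrib_right
       pol.scale_right_distrib ac_simps)

lemma nov_right_prelie: "(x \<lhd> y) \<lhd> z - x \<lhd> (y \<lhd> z) = (x \<lhd> z) \<lhd> y - x \<lhd> (z \<lhd> y)"
  by (simp add: nov_prod_def der_mult algebra_simps)

lemma nov_left_comm: "a \<lhd> (b \<lhd> c) = b \<lhd> (a \<lhd> c)"
  by (simp add: nov_prod_def algebra_simps)


section \<open>The formula for the product\<close>

definition lin_map :: "(('b::comm_monoid_add \<Rightarrow>\<^sub>0 rat) \<Rightarrow> ('c::comm_monoid_add \<Rightarrow>\<^sub>0 rat)) \<Rightarrow> bool" where
  "lin_map f \<longleftrightarrow> (\<forall>p q. f (p + q) = f p + f q) \<and> (\<forall>c p. f (rscale c p) = rscale c (f p))"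

lemma lin_map_zero:
  assumes "lin_map f"
  shows "f 0 = 0"
proof -
  have "f (0 + 0) = f 0 + f 0" using assms unfolding lin_map_def by blast
  then show ?thesis by simp
qed

lemma lin_map_ext: "lin_map (lin_ext f)"
  by (simp add: lin_map_def lin_ext_add lin_ext_rscale)

lemma lin_map_eq:
  assumes "lin_map f" "lin_map g" "\<And>b. f (mon b) = g (mon b)"
  shows "f p = g p"
proof (induction p rule: pol_induct)
  case zero
  show ?case using assms(1,2) by (simp add: lin_map_zero)
next
  case (mon b)
  show ?case by (rule assms(3))
next
  case (add p q)
  then show ?case using assms(1,2) by (simp add: lin_map_def)
next
  case (scale c p)
  then show ?case using assms(1,2) by (simp add: lin_map_def)
qed

lemma lin_map_compose: "lin_map f \<Longrightarrow> lin_map g \<Longrightarrow> lin_map (\<lambda>p. f (g p))"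
  by (simp add: lin_map_def)

lemma lin_map_mult_left: "lin_map f \<Longrightarrow> lin_map (\<lambda>p. f p * q)"
  by (simp add: lin_map_def distrib_right rscale_mult_left)

lemma lin_map_mult_right: "lin_map f \<Longrightarrow> lin_map (\<lambda>p. q * f p)"
  by (simp add: lin_map_def distrib_left rscale_mult_right)

lemma lin_map_sum: "(\<And>x. x \<in> A \<Longrightarrow> lin_map (f x)) \<Longrightarrow> lin_map (\<lambda>p. \<Sum>x\<in>A. f x p)"
  by (simp add: lin_map_def sum.distrib pol.scale_sum_right)

lemma lin_map_id: "lin_map (\<lambda>p. p)"
  by (simp add: lin_map_def)

lemma lin_map_sym_inj: "lin_map sym_inj"
  by (simp add: sym_inj_def lin_map_ext)

lemma lin_map_der_pow: "lin_map (der ^^ n)"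
  by (induction n) (simp_all add: lin_map_def der_add der_rscale)

lemma lin_map_prod:
  assumes "finite A" "a \<in> A" "lin_map (f a)" "\<And>x p q. x \<in> A \<Longrightarrow> x \<noteq> a \<Longrightarrow> f x p = f x q"
  shows "lin_map (\<lambda>p. \<Prod>x\<in>A. f x p)"
proof -
  have "(\<Prod>x\<in>A. f x p) = f a p * (\<Prod>x\<in>A - {a}. f x 0)" for p
    using assms(1,2,4) by (subst prod.remove[of A a]) (auto intro!: prod.cong arg_cong2[where f = "(*)"])
  then show ?thesis using lin_map_mult_left[OF assms(3)] by simp
qed

lemma list_multilinear_eq:
  fixes F G :: "('b::comm_monoid_add \<Rightarrow>\<^sub>0 rat) list \<Rightarrow> ('c::comm_monoid_add \<Rightarrow>\<^sub>0 rat)"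
  assumes F: "\<And>xs k. k < length xs \<Longrightarrow> lin_map (\<lambda>p. F (xs[k := p]))"
    and G: "\<And>xs k. k < length xs \<Longrightarrow> lin_map (\<lambda>p. G (xs[k := p]))"
    and eq: "\<And>bs. F (map mon bs) = G (map mon bs)"
  shows "F xs = G xs"
proof -
  have *: "F xs = G xs" if "\<forall>j. n \<le> j \<and> j < length xs \<longrightarrow> xs ! j \<in> range mon" for n xs
    using that
  proof (induction n arbitrary: xs)
    case 0
    then have "\<forall>x\<in>set xs. \<exists>b. x = mon b" by (fastforce simp: in_set_conv_nth)
    then obtain bs where "xs = map mon bs" by (metis ex_map_conv)
    then show ?case using eq by simp
  next
    case (Suc n)
    show ?case
    proof (cases "n < length xs")
      case True
      have "F (xs[n := p]) = G (xs[n := p])" for p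
      proof (rule lin_map_eq[OF F[OF True] G[OF True]])
        fix b show "F (xs[n := mon b]) = G (xs[n := mon b])"
          by (rule Suc.IH) (use Suc.prems in \<open>auto simp: nth_list_update\<close>)
      qed
      from this[of "xs ! n"] show ?thesis by simp
    next
      case False
      show ?thesis by (rule Suc.IH) (use False in auto)
    qed
  qed
  show ?thesis by (rule *[of "length xs"]) auto
qed

lemma block_familiesD:
  assumes "I \<in> block_families n m" "k \<le> n"
  shows "I k \<subseteq> {..<m}" "finite (I k)"
proof -
  show *: "I k \<subseteq> {..<m}" using assms by (auto simp: block_families_def PiE_iff)
  show "finite (I k)" using * finite_subset by blast
qed

lemma star_list_lin_left:
  assumes "k < length ws"
  shows "lin_map (\<lambda>p. star_list (ws[k := p]) zs)"
  unfolding star_list_def length_list_update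
proof (rule lin_map_sum, rule lin_map_mult_left, rule lin_map_prod[of _ k])
  fix I
  show "lin_map (\<lambda>p. sym_inj (brace (ws[k := p] ! k) ((!) zs) (I k)))"
    unfolding brace_def nth_list_update_eq[OF assms]
    by (intro lin_map_compose[OF lin_map_sym_inj] lin_map_mult_right lin_map_der_pow)
qed (use assms in auto)

lemma star_list_lin_right:
  assumes j: "j < length zs"
  shows "lin_map (\<lambda>p. star_list ws (zs[j := p]))"
  unfolding star_list_def length_list_update
proof (rule lin_map_sum)
  let ?n = "length ws"
  fix I assume I: "I \<in> block_families ?n (length zs)"
  then obtain l where l: "l \<le> ?n" "j \<in> I l"
    using j unfolding block_families_def by blast
  have uniq: "j \<notin> I k" if "k \<le> ?n" "k \<noteq> l" for k
    using I l that unfolding block_families_def disjoint_family_on_def by blast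
  have other: "(\<Prod>x\<in>I k. h (zs[j := p] ! x)) = (\<Prod>x\<in>I k. h (zs ! x))"
    if "k \<le> ?n" "k \<noteq> l" for k p and h :: "dpol \<Rightarrow> 'x::comm_monoid_mult"
    using uniq[OF that] by (intro prod.cong refl arg_cong[where f = h] nth_list_update_neq) auto
  have this_block: "lin_map (\<lambda>p. \<Prod>x\<in>I l. h (zs[j := p] ! x))"
    if "lin_map h" for h :: "dpol \<Rightarrow> ('x::comm_monoid_add \<Rightarrow>\<^sub>0 rat)"
    by (rule lin_map_prod[of _ j]) (use I l j that in \<open>auto dest: block_familiesD\<close>)
  show "lin_map (\<lambda>p. (\<Prod>k<?n. sym_inj (brace (ws ! k) ((!) (zs[j := p])) (I k))) *
      (\<Prod>x\<in>I ?n. sym_inj (zs[j := p] ! x)))"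
  proof (cases "l = ?n")
    case True
    have "brace (ws ! k) ((!) (zs[j := p])) (I k) = brace (ws ! k) ((!) zs) (I k)"
      if "k < ?n" for k p
      using other[of k "\<lambda>x. x"] that True by (simp add: brace_def)
    then show ?thesis
      using lin_map_mult_right[OF this_block[OF lin_map_sym_inj]] True by simp
  next
    case False
    then have "l < ?n" using l by simp
    have "lin_map (\<lambda>p. \<Prod>k<?n. sym_inj (brace (ws ! k) ((!) (zs[j := p])) (I k)))"
    proof (rule lin_map_prod[of _ l])
      show "lin_map (\<lambda>p. sym_inj (brace (ws ! l) ((!) (zs[j := p])) (I l)))"
        unfolding brace_def
        by (intro lin_map_compose[OF lin_map_sym_inj] lin_map_mult_left this_block[OF lin_map_id])
      show "sym_inj (brace (ws ! k) ((!) (zs[j := p])) (I k))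
          = sym_inj (brace (ws ! k) ((!) (zs[j := q])) (I k))"
        if "k \<in> {..<?n}" "k \<noteq> l" for k p q
        using other[of k "\<lambda>x. x"] that by (simp add: brace_def)
    qed (use \<open>l < ?n\<close> in auto)
    then show ?thesis
      using other[of ?n sym_inj] False by (simp add: lin_map_mult_left)
  qed
qed

lemma mset_eq_index_perm:
  assumes "mset xs = mset ys"
  obtains f where "bij_betw f {..<length xs} {..<length xs}" "\<And>i. i < length xs \<Longrightarrow> xs ! i = ys ! f i"
proof -
  obtain p where p: "p permutes {..<length ys}" "permute_list p ys = xs"
    using mset_eq_permutation[OF assms] by blast
  have "length xs = length ys" using assms mset_eq_length by blast
  with p show thesis
    by (intro that[of p]) (auto simp: permutes_imp_bij permute_list_nth)
qed

lemma star_list_perm_left: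
  assumes "mset ws = mset ws'"
  shows "star_list ws zs = star_list ws' zs"
proof -
  let ?n = "length ws" and ?m = "length zs"
  have len: "length ws' = ?n" using assms mset_eq_length by metis
  obtain f where f: "bij_betw f {..<?n} {..<?n}" "\<And>i. i < ?n \<Longrightarrow> ws ! i = ws' ! f i"
    using mset_eq_index_perm[OF assms] by blast
  define g where "g = inv_into {..<?n} f"
  have g: "bij_betw g {..<?n} {..<?n}" unfolding g_def by (rule bij_betw_inv_into[OF f(1)])
  have fg: "f (g x) = x" "g (f x) = x" if "x < ?n" for x
    using f(1) that by (auto simp: g_def bij_betw_inv_into_left bij_betw_inv_into_right)
  define ext where "ext h = (\<lambda>(I :: nat \<Rightarrow> nat set) k. if k < ?n then I (h k) else if k = ?n then I ?n else undefined)"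
    for h :: "nat \<Rightarrow> nat"
  have ext_in: "ext h I \<in> block_families ?n ?m"
    if I: "I \<in> block_families ?n ?m" and h: "bij_betw h {..<?n} {..<?n}" for h I
  proof -
    define h' where "h' k = (if k < ?n then h k else ?n)" for k
    have im: "h' ` {..?n} = {..?n}"
    proof -
      have "{..?n} = insert ?n {..<?n}" by auto
      moreover have "h' ` {..<?n} = h ` {..<?n}" by (rule image_cong) (simp_all add: h'_def)
      moreover have "h' ?n = ?n" by (simp add: h'_def)
      ultimately show ?thesis using h by (simp only: image_insert bij_betw_def)
    qed
    then have inj: "inj_on h' {..?n}" by (simp add: eq_card_imp_inj_on)
    have le: "h' k \<le> ?n" if "k \<le> ?n" for k using im that by blast
    have ext: "ext h I k = I (h' k)" if "k \<le> ?n" for k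
      using that by (auto simp: ext_def h'_def)
    have "(\<Union>k\<le>?n. ext h I k) = (\<Union>k\<in>h' ` {..?n}. I k)" by (simp add: ext)
    then have "(\<Union>k\<le>?n. ext h I k) = (\<Union>k\<le>?n. I k)" unfolding im .
    moreover have "disjoint_family_on (ext h I) {..?n}"
      unfolding disjoint_family_on_def
    proof (intro ballI impI)
      fix k l assume kl: "k \<in> {..?n}" "l \<in> {..?n}" "k \<noteq> l"
      then have "h' k \<noteq> h' l" using inj by (auto simp: inj_on_def)
      then show "ext h I k \<inter> ext h I l = {}"
        using I kl le by (simp add: ext block_families_def disjoint_family_on_def)
    qed
    moreover have "ext h I \<in> {..?n} \<rightarrow>\<^sub>E Pow {..<?m}"
    proof (rule PiE_I)
      fix k assume "k \<in> {..?n}"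
      then show "ext h I k \<in> Pow {..<?m}"
        using block_familiesD(1)[OF I le] by (simp add: ext)
    qed (simp add: ext_def)
    ultimately show ?thesis using I by (simp add: block_families_def)
  qed
  have ext_inv: "ext h (ext h' I) = I"
    if "I \<in> block_families ?n ?m" "bij_betw h {..<?n} {..<?n}" "\<And>x. x < ?n \<Longrightarrow> h' (h x) = x" for h h' I
  proof
    fix k
    have "h k < ?n" if "k < ?n"
      using \<open>bij_betw h {..<?n} {..<?n}\<close> that by (auto simp: bij_betw_def)
    moreover have "I k = undefined" if "\<not> k \<le> ?n"
      using \<open>I \<in> block_families ?n ?m\<close> that by (simp add: block_families_def PiE_iff extensional_def)
    ultimately show "ext h (ext h' I) k = I k"
      using \<open>\<And>x. x < ?n \<Longrightarrow> h' (h x) = x\<close> by (simp add: ext_def)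
  qed
  show ?thesis
    unfolding star_list_def len
  proof (rule sum.reindex_bij_witness[where i = "ext f" and j = "ext g"])
    fix I assume I: "I \<in> block_families ?n ?m"
    show "ext f (ext g I) = I" "ext g I \<in> block_families ?n ?m"
      using I f g fg by (auto intro: ext_inv ext_in)
    have "(\<Prod>k<?n. sym_inj (brace (ws' ! k) ((!) zs) (ext g I k)))
        = (\<Prod>k<?n. sym_inj (brace (ws' ! f k) ((!) zs) (ext g I (f k))))"
      by (rule prod.reindex_bij_betw[OF f(1), symmetric])
    also have "\<dots> = (\<Prod>k<?n. sym_inj (brace (ws ! k) ((!) zs) (I k)))"
    proof (rule prod.cong)
      fix k assume k: "k \<in> {..<?n}"
      then have "f k < ?n" using f(1) by (auto simp: bij_betw_def)
      then show "sym_inj (brace (ws' ! f k) ((!) zs) (ext g I (f k)))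
          = sym_inj (brace (ws ! k) ((!) zs) (I k))"
        using k f(2) fg by (simp add: ext_def)
    qed simp
    finally show "(\<Prod>k<?n. sym_inj (brace (ws' ! k) ((!) zs) (ext g I k))) *
        (\<Prod>j\<in>ext g I ?n. sym_inj (zs ! j)) =
        (\<Prod>k<?n. sym_inj (brace (ws ! k) ((!) zs) (I k))) * (\<Prod>j\<in>I ?n. sym_inj (zs ! j))"
      by (simp add: ext_def)
  next
    fix I assume I: "I \<in> block_families ?n ?m"
    show "ext g (ext f I) = I" "ext f I \<in> block_families ?n ?m"
      using I f g fg by (auto intro: ext_inv ext_in)
  qed
qed

lemma star_list_perm_right:
  assumes "mset zs = mset zs'"
  shows "star_list ws zs = star_list ws zs'"
proof -
  let ?n = "length ws" and ?m = "length zs"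
  have len: "length zs' = ?m" using assms mset_eq_length by metis
  obtain f where f: "bij_betw f {..<?m} {..<?m}" "\<And>i. i < ?m \<Longrightarrow> zs ! i = zs' ! f i"
    using mset_eq_index_perm[OF assms] by blast
  define g where "g = inv_into {..<?m} f"
  have g: "bij_betw g {..<?m} {..<?m}" unfolding g_def by (rule bij_betw_inv_into[OF f(1)])
  have fg: "f (g x) = x" "g (f x) = x" if "x < ?m" for x
    using f(1) that by (auto simp: g_def bij_betw_inv_into_left bij_betw_inv_into_right)
  define img where "img h = (\<lambda>(I :: nat \<Rightarrow> nat set). restrict (\<lambda>k. h ` I k) {..?n})"
    for h :: "nat \<Rightarrow> nat"
  have img_in: "img h I \<in> block_families ?n ?m"
    if I: "I \<in> block_families ?n ?m" and h: "bij_betw h {..<?m} {..<?m}" for h I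
  proof -
    have U: "(\<Union>k\<le>?n. I k) = {..<?m}" using I by (simp add: block_families_def)
    have "(\<Union>k\<le>?n. img h I k) = h ` (\<Union>k\<le>?n. I k)" by (auto simp: img_def)
    also have "\<dots> = {..<?m}" using h U by (simp add: bij_betw_def)
    finally have U': "(\<Union>k\<le>?n. img h I k) = {..<?m}" .
    have "h ` I k \<inter> h ` I l = {}" if "k \<le> ?n" "l \<le> ?n" "k \<noteq> l" for k l
    proof -
      have "I k \<inter> I l = {}"
        using I that by (auto simp: block_families_def disjoint_family_on_def)
      then show ?thesis
        using inj_on_image_Int[of h "{..<?m}" "I k" "I l"] h block_familiesD(1)[OF I] that
        by (simp add: bij_betw_def)
    qed
    then have "disjoint_family_on (img h I) {..?n}"
      by (simp add: disjoint_family_on_def img_def)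
    with U' show ?thesis
      unfolding block_families_def by (auto simp: img_def)
  qed
  have img_inv: "img h (img h' I) = I"
    if I: "I \<in> block_families ?n ?m" and hh: "\<And>x. x < ?m \<Longrightarrow> h (h' x) = x" for h h' I
  proof
    fix k
    show "img h (img h' I) k = I k"
    proof (cases "k \<le> ?n")
      case True
      then have "(h (h' x)) = x" if "x \<in> I k" for x
        using block_familiesD(1)[OF I True] hh that by auto
      then show ?thesis using True by (simp add: img_def image_image)
    next
      case False
      then show ?thesis using I by (simp add: img_def block_families_def PiE_iff extensional_def)
    qed
  qed
  have prods: "(\<Prod>x\<in>h ` I k. e (zs' ! x)) = (\<Prod>x\<in>I k. e (zs ! x))"
    if "I \<in> block_families ?n ?m" "k \<le> ?n" "h = f" for I k h and e :: "dpol \<Rightarrow> 'x::comm_monoid_mult"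
  proof -
    have "I k \<subseteq> {..<?m}" using that block_familiesD by blast
    moreover from this have "inj_on f (I k)" using f(1) inj_on_subset by (auto simp: bij_betw_def)
    ultimately show ?thesis using f(2) that(3)
      by (subst prod.reindex) (auto intro!: prod.cong)
  qed
  have cards: "card (f ` I k) = card (I k)" if "I \<in> block_families ?n ?m" "k \<le> ?n" for I k
  proof -
    have "I k \<subseteq> {..<?m}" using that block_familiesD by blast
    then have "inj_on f (I k)" using f(1) inj_on_subset by (auto simp: bij_betw_def)
    then show ?thesis by (rule card_image)
  qed
  show ?thesis
    unfolding star_list_def len
  proof (rule sum.reindex_bij_witness[where i = "img g" and j = "img f"])
    fix I assume I: "I \<in> block_families ?n ?m"
    show "img g (img f I) = I" "img f I \<in> block_families ?n ?m"
      using I f g fg by (auto intro: img_inv img_in)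
    show "(\<Prod>k<?n. sym_inj (brace (ws ! k) ((!) zs') (img f I k))) *
        (\<Prod>j\<in>img f I ?n. sym_inj (zs' ! j)) =
        (\<Prod>k<?n. sym_inj (brace (ws ! k) ((!) zs) (I k))) * (\<Prod>j\<in>I ?n. sym_inj (zs ! j))"
      using prods[OF I, of _ f "\<lambda>x. x"] prods[OF I, of _ f sym_inj] cards[OF I]
      by (simp add: img_def brace_def)
  next
    fix I assume I: "I \<in> block_families ?n ?m"
    show "img f (img g I) = I" "img g I \<in> block_families ?n ?m"
      using I f g fg by (auto intro: img_inv img_in)
  qed
qed

lemma lin_map_star_left: "lin_map (\<lambda>P. P \<star> Q)"
  unfolding star_def by (rule lin_map_ext)

lemma lin_map_star_right: "lin_map (\<lambda>Q. P \<star> Q)"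
  unfolding star_def lin_ext_def[of _ P]
  by (intro lin_map_sum) (simp add: lin_map_def lin_ext_add lin_ext_rscale pol.scale_right_distrib
      mult.commute)

lemma prod_list_sym_inj_mon: "prod_list (map sym_inj (map mon bs)) = mon (mset bs)"
  by (induction bs) (simp_all add: mon_zero mon_mult)

lemma lin_map_prod_list_sym_inj:
  assumes "k < length xs"
  shows "lin_map (\<lambda>p. prod_list (map sym_inj (xs[k := p])))"
proof -
  have "prod_list (map sym_inj (xs[k := p]))
      = prod_list (map sym_inj (take k xs)) * (sym_inj p * prod_list (map sym_inj (drop (Suc k) xs)))"
    for p
    using assms by (simp add: upd_conv_take_nth_drop)
  then show ?thesis
    by (simp add: lin_map_mult_right lin_map_mult_left lin_map_sym_inj)
qed

theorem star_formula:
  "prod_list (map sym_inj ws) \<star> prod_list (map sym_inj zs) = star_list ws zs"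
proof -
  have basis: "prod_list (map sym_inj (map mon as)) \<star> prod_list (map sym_inj (map mon bs))
      = star_list (map mon as) (map mon bs)" for as bs
  proof -
    have S: "mset (SOME xs. mset xs = mset as) = mset as" for as :: "'x list"
      by (rule someI[of "\<lambda>xs. mset xs = mset as"]) simp
    have M: "mset (map mon (SOME xs. mset xs = mset as)) = mset (map mon as)"
      for as :: "(nat \<times> int) multiset list"
      by (simp only: mset_map S)
    show ?thesis
      unfolding prod_list_sym_inj_mon star_def lin_ext_mon
      using star_list_perm_left[OF M[of as]] star_list_perm_right[OF M[of bs]] by metis
  qed
  have right: "prod_list (map sym_inj (map mon as)) \<star> prod_list (map sym_inj zs)
      = star_list (map mon as) zs" for as
    by (rule list_multilinear_eq)
       (auto intro: star_list_lin_right lin_map_compose[OF lin_map_star_right]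
          lin_map_prod_list_sym_inj simp del: map_map simp: basis map_update[symmetric])
  show ?thesis
    by (rule list_multilinear_eq[where xs = ws])
       (auto intro: star_list_lin_left lin_map_compose[OF lin_map_star_left]
          lin_map_prod_list_sym_inj simp del: map_map simp: right)
qed


section \<open>Closure of the carriers\<close>

definition dweight :: "nat \<Rightarrow> int \<Rightarrow> dpol set" where
  "dweight i w = pol.span (mon ` {m \<in> dmonomials i. weight m = w})"

lemma novikov_dweight: "novikov i = dweight i (-1)"
  by (simp add: novikov_def dweight_def nov_monomials_def)

lemma span_lin_map:
  assumes "p \<in> pol.span (mon ` M)" "lin_map f" "\<And>m. m \<in> M \<Longrightarrow> f (mon m) \<in> pol.span T"
  shows "f p \<in> pol.span T"
  using assms(1)
proof (induction rule: pol.span_induct)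
  case base
  show ?case using assms(2)
    by (auto simp: pol.subspace_def lin_map_zero lin_map_def pol.span_zero pol.span_add pol.span_scale)
next
  case (step x)
  then show ?case using assms(3) by auto
qed

lemma dweight_mult:
  assumes "p \<in> dweight i w" "q \<in> dweight i w'"
  shows "p * q \<in> dweight i (w + w')"
  unfolding dweight_def
proof (rule span_lin_map[OF assms(1)[unfolded dweight_def] lin_map_mult_left[OF lin_map_id]],
    rule span_lin_map[OF assms(2)[unfolded dweight_def] lin_map_mult_right[OF lin_map_id]])
  fix m n
  assume "m \<in> {m \<in> dmonomials i. weight m = w}" "n \<in> {m \<in> dmonomials i. weight m = w'}"
  then show "mon m * mon n \<in> pol.span (mon ` {m \<in> dmonomials i. weight m = w + w'})"
    unfolding mon_mult
    by (intro pol.span_base imageI) (auto simp: dmonomials_def weight_def)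
qed

lemma dweight_der:
  assumes "p \<in> dweight i w"
  shows "der p \<in> dweight i (w + 1)"
  unfolding dweight_def der_def
proof (rule span_lin_map[OF assms[unfolded dweight_def] lin_map_ext], unfold lin_ext_mon)
  fix m assume m: "m \<in> {m \<in> dmonomials i. weight m = w}"
  let ?T = "pol.span (mon ` {m \<in> dmonomials i. weight m = w + 1})"
  have v: "mon (m - {#v#} + {#(fst v, snd v + 1)#}) \<in> ?T" if "v \<in># m" for v
  proof -
    obtain n where n: "m = add_mset v n" using multi_member_split[OF \<open>v \<in># m\<close>] by blast
    have "n + {#(fst v, snd v + 1)#} \<in> dmonomials i"
      using m unfolding n by (auto simp: dmonomials_def)
    moreover have "weight (n + {#(fst v, snd v + 1)#}) = w + 1"
      using m unfolding n by (simp add: weight_def)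
    ultimately show ?thesis
      unfolding n by (intro pol.span_base imageI) simp
  qed
  have sum: "(\<Sum>v\<in>#n. f v) \<in> ?T" if "\<And>v. v \<in># n \<Longrightarrow> f v \<in> ?T" for n and f :: "nat \<times> int \<Rightarrow> dpol"
    using that
  proof (induction n)
    case empty
    show ?case by (simp add: pol.span_zero)
  next
    case (add x n)
    then show ?case by (simp add: pol.span_add)
  qed
  show "(\<Sum>v\<in>#m. mon (m - {#v#} + {#(fst v, snd v + 1)#})) \<in> ?T"
    by (rule sum) (rule v)
qed

lemma dweight_der_pow: "p \<in> dweight i w \<Longrightarrow> (der ^^ n) p \<in> dweight i (w + int n)"
proof (induction n)
  case (Suc n)
  have "w + int n + 1 = w + int (Suc n)" by simp
  then show ?case using dweight_der[OF Suc.IH[OF Suc.prems]] by (simp only: funpow.simps o_apply)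
qed simp

lemma generator_in_novikov: "1 \<le> r \<Longrightarrow> r \<le> i \<Longrightarrow> generator r \<in> novikov i"
  unfolding novikov_def generator_def avar_def
  by (intro pol.span_base imageI) (simp add: nov_monomials_def dmonomials_def weight_def)

lemma nov_prod_closed: "u \<in> novikov i \<Longrightarrow> v \<in> novikov i \<Longrightarrow> u \<lhd> v \<in> novikov i"
  using dweight_mult[OF dweight_der, of u i "-1" v "-1"] by (simp add: novikov_dweight nov_prod_def)

lemma brace_closed:
  assumes "u \<in> novikov i" "\<And>j. j \<in> J \<Longrightarrow> z j \<in> novikov i" "finite J"
  shows "brace u z J \<in> novikov i"
proof -
  have "(\<Prod>j\<in>J. z j) * (der ^^ n) u \<in> dweight i (int n - 1 - int (card J))" for n
    using assms(3,2)
  proof (induction J)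
    case empty
    then show ?case
      using dweight_der_pow[of u i "-1" n] assms(1) by (simp add: novikov_dweight)
  next
    case (insert x F)
    then have "z x * ((\<Prod>j\<in>F. z j) * (der ^^ n) u) \<in> dweight i (-1 + (int n - 1 - int (card F)))"
      by (intro dweight_mult) (auto simp: novikov_dweight)
    then show ?case using insert by (simp add: mult.assoc algebra_simps)
  qed
  from this[of "card J"] show ?thesis by (simp add: brace_def novikov_dweight)
qed

lemma sym_inj_closed: "u \<in> novikov i \<Longrightarrow> sym_inj u \<in> sym_novikov i"
  unfolding sym_novikov_def
  by (rule span_lin_map[OF _ lin_map_sym_inj, of _ "nov_monomials i"])
     (auto simp: novikov_def intro: pol.span_base)

lemma sym_novikov_one: "1 \<in> sym_novikov i"
  unfolding sym_novikov_def mon_zero[symmetric] by (intro pol.span_base) auto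

lemma sym_novikov_mult:
  assumes "P \<in> sym_novikov i" "Q \<in> sym_novikov i"
  shows "P * Q \<in> sym_novikov i"
  unfolding sym_novikov_def
  by (rule span_lin_map[OF assms(1)[unfolded sym_novikov_def] lin_map_mult_left[OF lin_map_id]],
      rule span_lin_map[OF assms(2)[unfolded sym_novikov_def] lin_map_mult_right[OF lin_map_id]])
     (unfold mon_mult, intro pol.span_base imageI, auto)

lemma sym_novikov_prod:
  "(\<And>x. x \<in> A \<Longrightarrow> f x \<in> sym_novikov i) \<Longrightarrow> (\<Prod>x\<in>A. f x) \<in> sym_novikov i"
  by (induction A rule: infinite_finite_induct) (auto intro: sym_novikov_one sym_novikov_mult)

lemma star_list_closed:
  assumes "set ws \<subseteq> novikov i" "set zs \<subseteq> novikov i"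
  shows "star_list ws zs \<in> sym_novikov i"
proof -
  have zs: "zs ! j \<in> novikov i"
    if "I \<in> block_families (length ws) (length zs)" "k \<le> length ws" "j \<in> I k" for I j k
    using block_familiesD(1)[OF that(1,2)] that(3) assms(2) by (auto simp: subset_iff)
  have "(\<Prod>k<length ws. sym_inj (brace (ws ! k) ((!) zs) (I k))) *
      (\<Prod>j\<in>I (length ws). sym_inj (zs ! j)) \<in> sym_novikov i"
    if I: "I \<in> block_families (length ws) (length zs)" for I
    by (intro sym_novikov_mult sym_novikov_prod sym_inj_closed brace_closed)
       (use assms(1) zs[OF I] zs[OF I less_imp_le] block_familiesD(2)[OF I] in \<open>auto simp: less_imp_le\<close>)
  then show ?thesis
    unfolding star_list_def by (auto simp: sym_novikov_def intro: pol.span_sum)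
qed

lemma star_closed:
  assumes "P \<in> sym_novikov i" "Q \<in> sym_novikov i"
  shows "P \<star> Q \<in> sym_novikov i"
  unfolding sym_novikov_def
proof (rule span_lin_map[OF assms(1)[unfolded sym_novikov_def] lin_map_star_left],
    rule span_lin_map[OF assms(2)[unfolded sym_novikov_def] lin_map_star_right])
  fix W Z
  assume "W \<in> {W. \<forall>m\<in>#W. m \<in> nov_monomials i}" "Z \<in> {W. \<forall>m\<in>#W. m \<in> nov_monomials i}"
  moreover obtain ws zs where "W = mset ws" "Z = mset zs" by (metis ex_mset)
  ultimately have "mon W \<star> mon Z = star_list (map mon ws) (map mon zs)"
    "set (map mon ws) \<subseteq> novikov i" "set (map mon zs) \<subseteq> novikov i"
    using star_formula[of "map mon ws" "map mon zs", unfolded prod_list_sym_inj_mon]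
    by (auto simp: novikov_def intro: pol.span_base)
  then show "mon W \<star> mon Z \<in> pol.span (mon ` {W. \<forall>m\<in>#W. m \<in> nov_monomials i})"
    using star_list_closed by (simp add: sym_novikov_def)
qed

end

theory Submission
  imports Defs
begin

text \<open>
  Multiplying a product of elements \<open>z\<^sub>D\<close> on the left by the generator \<open>a\<^bsup>[M]\<^esup>\<close> picks some of the
  factors and grafts them below \<open>a\<^bsup>[M]\<^esup>\<close>: it replaces the picked \<open>Q\<close> by the single factor
  \<open>a\<^bsup>[M]\<^esup>\<^sub>q\<^sub>-\<^sub>1 \<Prod>\<^sub>D z\<^sub>D\<close> with \<open>q = |Q|\<close>. Hence the product of the generators is a sum over set partitions
  in which a block \<open>C \<union> {M}\<close> with maximum \<open>M\<close> contributes \<open>T(C \<union> {M}) = \<Sum>\<^sub>Q a\<^bsup>[M]\<^esup>\<^sub>q\<^sub>-\<^sub>1 \<Prod>\<^sub>D T(D)\<close>, \<open>Q\<close>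
  running over the set partitions of \<open>C\<close>. The block sums satisfy this recursion because a word
  records the numbers of children in a forest built by adding the vertices in increasing order: when
  vertex \<open>j\<close> arrives there are \<open>d\<^sub>j + w\<^sub>j\<close> roots, \<open>w\<^sub>j\<close> of which become its children. To make the
  induction work, forests with \<open>l\<close> roots are admitted with an arbitrary weight \<open>\<phi> l\<close>.
\<close>

section \<open>Sums over set partitions\<close>

abbreviation parts :: "'a set \<Rightarrow> 'a set set set" where
  "parts A \<equiv> {P. partition_on A P}"

lemma finite_block: "finite A \<Longrightarrow> partition_on A P \<Longrightarrow> D \<in> P \<Longrightarrow> finite D"
  using finite_subset[of D A] by (auto simp: partition_on_def)

text \<open>A partition of \<open>insert M A\<close> is determined by the block
  \<open>insert M C\<close> that contains \<open>M\<close> and by the partition \<open>R\<close>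
  formed by the other blocks.\<close>

lemma sum_parts_insert:
  assumes "finite A" "M \<notin> A"
  shows "(\<Sum>P\<in>parts (insert M A). f P)
    = (\<Sum>C\<in>Pow A. \<Sum>R\<in>parts (A - C). f (insert (insert M C) R))"
proof -
  let ?h = "\<lambda>(C, R). insert (insert M C) R"
  let ?S = "Sigma (Pow A) (\<lambda>C. parts (A - C))"
  have sub: "\<Union>R = A - C" if "(C, R) \<in> ?S" for C R
    using that by (auto simp: partition_on_def)
  have not_in: "M \<notin> D" if "(C, R) \<in> ?S" "D \<in> R" for C R D
    using sub[OF that(1)] that(2) assms(2) by blast
  have block_not_in: "insert M C \<notin> R" if "(C, R) \<in> ?S" for C R
    using sub[OF that] assms(2) by blast
  have "bij_betw ?h ?S (parts (insert M A))"
  proof (rule bij_betw_imageI)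
    show "inj_on ?h ?S"
    proof (rule inj_onI, clarify)
      fix C R C' R' assume h: "insert (insert M C) R = insert (insert M C') R'"
        and CR: "C \<subseteq> A" "partition_on (A - C) R" "C' \<subseteq> A" "partition_on (A - C') R'"
      then have in_S: "(C, R) \<in> ?S" "(C', R') \<in> ?S" by auto
      have block: "insert M C = insert M C'"
      proof -
        have "insert M C \<in> insert (insert M C') R'" using h by (metis insertI1)
        then show ?thesis using not_in[OF in_S(2), of "insert M C"] by blast
      qed
      moreover have "M \<notin> C" "M \<notin> C'" using CR assms(2) by blast+
      ultimately have "C = C'" by (simp add: insert_ident)
      moreover have "R = R'"
        using h block_not_in[OF in_S(1)] block_not_in[OF in_S(2)] by (simp add: block insert_ident)
      ultimately show "C = C' \<and> R = R'" by blast
    qed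
    show "?h ` ?S = parts (insert M A)"
    proof (rule set_eqI, rule iffI)
      fix P assume "P \<in> ?h ` ?S"
      then obtain C R where P: "P = insert (insert M C) R" "C \<subseteq> A" "partition_on (A - C) R"
        by auto
      have "insert M A - insert M C = A - C" using assms(2) by auto
      moreover have "disjnt (insert M C) (\<Union>R)"
        using P assms(2) by (auto simp: partition_on_def disjnt_def)
      ultimately show "P \<in> parts (insert M A)"
        using P by (auto simp: partition_on_insert)
    next
      fix P assume "P \<in> parts (insert M A)"
      then have P: "\<Union>P = insert M A" "disjoint P" "{} \<notin> P" by (auto simp: partition_on_def)
      then obtain B where B: "B \<in> P" "M \<in> B" by blast
      have "\<Union>(P - {B}) = A - (B - {M})"
      proof -
        have "B \<inter> D = {}" if "D \<in> P - {B}" for D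
          using P(2) B(1) that by (auto simp: disjoint_def)
        then have "\<Union>(P - {B}) = \<Union>P - B" using B(1) by blast
        also have "\<dots> = A - (B - {M})" unfolding P(1) using B(2) assms(2) by auto
        finally show ?thesis .
      qed
      moreover have "disjoint (P - {B})" using pairwise_subset[OF P(2)] by blast
      moreover have "B - {M} \<subseteq> A" using P(1) B(1) by blast
      ultimately have "(B - {M}, P - {B}) \<in> ?S"
        using P(3) by (simp add: partition_on_def)
      moreover have "?h (B - {M}, P - {B}) = P"
        using B by (simp add: insert_absorb)
      ultimately show "P \<in> ?h ` ?S" by (metis (no_types, lifting) image_eqI)
    qed
  qed
  then have "(\<Sum>P\<in>parts (insert M A). f P) = (\<Sum>x\<in>?S. f (?h x))"
    by (rule sum.reindex_bij_betw[symmetric])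
  also have "\<dots> = (\<Sum>C\<in>Pow A. \<Sum>R\<in>parts (A - C). f (insert (insert M C) R))"
    using assms(1) by (subst sum.Sigma) (auto simp: finitely_many_partition_on intro!: sum.cong)
  finally show ?thesis .
qed

text \<open>Selecting some blocks \<open>Q\<close> of a partition of \<open>A\<close> amounts to
  choosing their union \<open>C\<close>, then partitioning \<open>C\<close> and \<open>A - C\<close>
  independently. This turns the choice of grafted factors into the data needed for the recursion on
  blocks.\<close>

lemma sum_parts_subset:
  assumes "finite A"
  shows "(\<Sum>P\<in>parts A. \<Sum>Q\<in>Pow P. f Q (P - Q))
    = (\<Sum>C\<in>Pow A. \<Sum>Q\<in>parts C. \<Sum>R\<in>parts (A - C). f Q R)"
proof -
  have fin: "finite P" if "P \<in> parts A" for P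
    using assms that finite_elements by blast
  have "(\<Sum>P\<in>parts A. \<Sum>Q\<in>Pow P. f Q (P - Q)) = (\<Sum>(P, Q)\<in>Sigma (parts A) Pow. f Q (P - Q))"
    using assms fin by (subst sum.Sigma) (auto simp: finitely_many_partition_on)
  also have "\<dots> = (\<Sum>(C, Q, R)\<in>Sigma (Pow A) (\<lambda>C. parts C \<times> parts (A - C)). f Q R)"
  proof (rule sum.reindex_bij_witness[where i = "\<lambda>(C, Q, R). (Q \<union> R, Q)"
        and j = "\<lambda>(P, Q). (\<Union>Q, Q, P - Q)"], goal_cases)
    case (1 x)
    then show ?case by auto
  next
    case (2 x)
    then obtain P Q where x: "x = (P, Q)" "Q \<subseteq> P" "partition_on A P" by auto
    have "\<Union>(P - Q) = A - \<Union>Q"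
    proof -
      have "D \<inter> E = {}" if "D \<in> P - Q" "E \<in> Q" for D E
      proof -
        have "disjoint P" "E \<in> P" "D \<noteq> E" using that x by (auto simp: partition_on_def)
        then show ?thesis using that unfolding disjoint_def by blast
      qed
      then show ?thesis using x by (auto simp: partition_on_def)
    qed
    moreover have "disjoint Q" "disjoint (P - Q)" "{} \<notin> P"
      using x pairwise_subset[of disjnt P] by (auto simp: partition_on_def)
    ultimately show ?case using x by (auto simp: partition_on_def)
  next
    case (3 y)
    then obtain C Q R where y: "y = (C, Q, R)" "C \<subseteq> A" "partition_on C Q" "partition_on (A - C) R"
      by auto
    \<comment> \<open>A common block would be a nonempty subset of both \<open>C\<close> and
      \<open>A - C\<close>. Disjointness makes \<open>(Q \<union> R) - Q\<close> equal to
      \<open>R\<close>.\<close>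
    have "Q \<inter> R = {}"
    proof (rule ccontr)
      assume "Q \<inter> R \<noteq> {}"
      then obtain D where "D \<in> Q" "D \<in> R" by blast
      then have "D \<subseteq> C" "D \<subseteq> A - C" "D \<noteq> {}" using y by (auto simp: partition_on_def)
      then show False by blast
    qed
    moreover have "\<Union>Q = C" using y by (simp add: partition_on_def)
    ultimately show ?case using y by auto
  next
    case (4 y)
    then obtain C Q R where y: "y = (C, Q, R)" "C \<subseteq> A" "partition_on C Q" "partition_on (A - C) R"
      by auto
    then have "partition_on (C \<union> (A - C)) (Q \<union> R)"
      using disjoint_union[of Q R] by (auto simp: partition_on_def)
    moreover have "C \<union> (A - C) = A" using y by auto
    ultimately show ?case using y by simp
  next
    case (5 x)
    then show ?case by auto
  qed
  also have "\<dots> = (\<Sum>C\<in>Pow A. \<Sum>(Q, R)\<in>parts C \<times> parts (A - C). f Q R)"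
    using assms by (subst sum.Sigma) (auto simp: finitely_many_partition_on finite_subset)
  also have "\<dots> = (\<Sum>C\<in>Pow A. \<Sum>Q\<in>parts C. \<Sum>R\<in>parts (A - C). f Q R)"
    by (simp add: sum.cartesian_product)
  finally show ?thesis .
qed

text \<open>Disjoint nonempty blocks have distinct minima, so each partition has exactly one
  enumeration by increasing minima. The outer sum over \<open>k\<close> sorts these enumerations by
  length.\<close>

lemma sum_ordered_partitions:
  fixes f :: "nat set \<Rightarrow> 'b::comm_semiring_1"
  assumes "i \<ge> 1"
  shows "(\<Sum>k=1..i. \<Sum>Is\<in>ordered_partitions i k. \<Prod>j<k. f (Is ! j))
    = (\<Sum>P\<in>parts {1..i}. \<Prod>D\<in>P. f D)"
proof -
  define L where "L = {Is. partition_on {1..i} (set Is) \<and> sorted_wrt (<) (map Min Is)}"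
  have Min_in: "Min D \<in> D" if "partition_on {1..i} P" "D \<in> P" for P D
    using that finite_block[OF _ that] by (intro Min_in) (auto simp: partition_on_def)
  have inj: "inj_on Min P" if P: "partition_on {1..i} P" for P
  proof (rule inj_onI)
    fix D E assume "D \<in> P" "E \<in> P" "Min D = Min E"
    then show "D = E"
      using P Min_in[OF P] by (metis partition_onD2 disjointD disjoint_iff)
  qed
  have "bij_betw set L (parts {1..i})"
  proof (rule bij_betw_imageI)
    show "inj_on set L"
    proof (rule inj_onI)
      fix Is Js assume *: "Is \<in> L" "Js \<in> L" "set Is = set Js"
      then have "map Min Is = map Min Js"
        by (intro sorted_distinct_set_unique) (auto simp: L_def strict_sorted_iff)
      then show "Is = Js"
        using * inj[of "set Is"] by (auto simp: L_def intro: map_inj_on)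
    qed
    show "set ` L = parts {1..i}"
    proof (rule set_eqI, rule iffI)
      fix P assume "P \<in> parts {1..i}"
      then have P: "partition_on {1..i} P" "finite P" using finite_elements by auto
      \<comment> \<open>Sort the minima, then replace each one by the block it comes from.\<close>
      define Is where "Is = map (inv_into P Min) (sorted_list_of_set (Min ` P))"
      have "map Min Is = sorted_list_of_set (Min ` P)"
        unfolding Is_def map_map using P(2) by (intro map_idI) (auto simp: f_inv_into_f)
      moreover have "set Is = P"
        using inj[OF P(1)] P(2) by (auto simp: Is_def image_image)
      ultimately show "P \<in> set ` L"
        using P by (auto simp: L_def intro!: image_eqI[of _ _ Is])
    qed (auto simp: L_def)
  qed
  then have bij: "(\<Sum>P\<in>parts {1..i}. \<Prod>D\<in>P. f D) = (\<Sum>Is\<in>L. \<Prod>D\<in>set Is. f D)"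
    and fin: "finite L"
    using bij_betw_finite finitely_many_partition_on[of "{1..i}"]
    by (simp_all add: sum.reindex_bij_betw) blast
  \<comment> \<open>The minima are distinct elements of \<open>{1..i}\<close>, which bounds the
    number of blocks by \<open>i\<close>; \<open>i \<ge> 1\<close> rules out the empty list.\<close>
  have "length Is \<in> {1..i}" if "Is \<in> L" for Is
  proof -
    have P: "partition_on {1..i} (set Is)" and "distinct Is"
      using that by (auto simp: L_def strict_sorted_iff distinct_map)
    have "Min ` set Is \<subseteq> {1..i}" using P Min_in[OF P] by (auto simp: partition_on_def)
    then have "card (set Is) \<le> i" using card_inj_on_le[OF inj[OF P], of "{1..i}"] by simp
    moreover have "Is \<noteq> []" using P assms by (auto simp: partition_on_def)
    ultimately show ?thesis using distinct_card[OF \<open>distinct Is\<close>] by (cases Is) auto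
  qed
  then have "(\<Sum>k=1..i. sum g {Is \<in> L. length Is = k}) = sum g L" for g :: "nat set list \<Rightarrow> 'b"
    using fin by (intro sum.group) auto
  moreover have "(\<Sum>Is\<in>ordered_partitions i k. \<Prod>j<k. f (Is ! j))
      = (\<Sum>Is\<in>{Is \<in> L. length Is = k}. \<Prod>D\<in>set Is. f D)" for k
  proof (rule sum.cong)
    fix Is assume "Is \<in> {Is \<in> L. length Is = k}"
    then have "distinct Is" "length Is = k" by (auto simp: L_def strict_sorted_iff distinct_map)
    then show "(\<Prod>j<k. f (Is ! j)) = (\<Prod>D\<in>set Is. f D)"
      using bij_betw_nth[of Is "{..<k}" "set Is"] by (auto intro: prod.reindex_bij_betw)
  qed (auto simp: ordered_partitions_def L_def)
  ultimately show ?thesis by (simp add: bij del: One_nat_def)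
qed


section \<open>Sums over words\<close>

text \<open>
  The words of forests with \<open>n\<close> vertices; \<open>n - sum_list w\<close> is the number of roots.
\<close>

definition forest_words :: "nat \<Rightarrow> nat list set" where
  "forest_words n = {w. length w = n \<and> (\<forall>j. 1 \<le> j \<and> j \<le> n \<longrightarrow> sum_list (take j w) \<le> j - 1)}"

text \<open>Words with total \<open>n - 1\<close> are the forests with a single root; the extra
  bound of \<open>forest_words\<close> at \<open>j = n\<close> is implied by that total.\<close>

lemma words_eq: "n \<ge> 1 \<Longrightarrow> words n = {w \<in> forest_words n. n - sum_list w = 1}"
proof (rule set_eqI)
  fix w
  assume n: "n \<ge> 1"
  have "sum_list (take j w) \<le> j - 1"
    if "w \<in> words n" "1 \<le> j" "j \<le> n" for j
    using that by (cases "j = n") (auto simp: words_def)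
  moreover have "sum_list w \<le> n - 1" if "w \<in> forest_words n"
    using that n by (auto simp: forest_words_def dest: spec[of _ n])
  ultimately show "w \<in> words n \<longleftrightarrow> w \<in> {w \<in> forest_words n. n - sum_list w = 1}"
    using n unfolding words_def forest_words_def by auto
qed

lemma forest_words_0: "forest_words 0 = {[]}"
  by (auto simp: forest_words_def)

lemma forest_words_sum_le: "w \<in> forest_words n \<Longrightarrow> sum_list w \<le> n"
  by (cases n) (auto simp: forest_words_def dest: spec[of _ n])

text \<open>The new vertex may adopt any number \<open>s\<close> of the current
  \<open>n - sum_list w\<close> roots: the bound at the last position says
  \<open>sum_list w + s \<le> n\<close>.\<close>

lemma forest_words_Suc:
  "bij_betw (\<lambda>(w, s). w @ [s]) (SIGMA w:forest_words n. {..n - sum_list w}) (forest_words (Suc n))"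
proof (rule bij_betw_imageI)
  have eq: "w @ [s] \<in> forest_words (Suc n) \<longleftrightarrow> w \<in> forest_words n \<and> s \<le> n - sum_list w" for w s
  proof (cases "length w = n")
    case True
    have "w @ [s] \<in> forest_words (Suc n) \<longleftrightarrow> w \<in> forest_words n \<and> sum_list w + s \<le> n"
      using True by (auto simp: forest_words_def le_Suc_eq)
    then show ?thesis using forest_words_sum_le[of w n] by auto
  qed (auto simp: forest_words_def)
  show "(\<lambda>(w, s). w @ [s]) ` (SIGMA w:forest_words n. {..n - sum_list w}) = forest_words (Suc n)"
  proof (rule set_eqI, rule iffI)
    fix v assume v: "v \<in> forest_words (Suc n)"
    then obtain w s where "v = w @ [s]" by (cases v rule: rev_cases) (auto simp: forest_words_def)
    then show "v \<in> (\<lambda>(w, s). w @ [s]) ` (SIGMA w:forest_words n. {..n - sum_list w})"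
      using v eq by force
  qed (auto simp: eq)
qed (auto simp: inj_on_def)

lemma finite_forest_words: "finite (forest_words n)"
  by (induction n) (auto simp: forest_words_0 bij_betw_finite[OF forest_words_Suc, symmetric])

text \<open>Earlier factors depend only on prefixes of \<open>w\<close>. At the last position
  \<open>d + s\<close> is the number of roots before the new vertex arrives, since the second
  hypothesis prevents truncation.\<close>

lemma word_coeff_append:
  assumes "length w = n" "sum_list w + s \<le> n"
  shows "word_coeff (w @ [s]) = word_coeff w * ((n - sum_list w) choose s)"
proof -
  have "(\<Prod>j=1..n. (word_d (w @ [s]) j + (w @ [s]) ! (j - 1)) choose ((w @ [s]) ! (j - 1)))
      = word_coeff w"
    using assms(1) unfolding word_coeff_def by (intro prod.cong) (auto simp: word_d_def nth_append)
  moreover have "word_d (w @ [s]) (Suc n) + (w @ [s]) ! n = n - sum_list w"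
    using assms by (simp add: word_d_def nth_append)
  ultimately show ?thesis using assms(1) by (simp add: word_coeff_def nth_append)
qed

section \<open>Forest words weighted by the number of roots\<close>

definition word_sum :: "(nat \<Rightarrow> dpol) \<Rightarrow> nat list \<Rightarrow> dpol" where
  "word_sum \<phi> xs = (\<Sum>w\<in>forest_words (length xs). of_nat (word_coeff w) *
      (\<Prod>j=1..length xs. avar (xs ! (j - 1)) (int (w ! (j - 1)) - 1)) * \<phi> (length xs - sum_list w))"

text \<open>The effect on weights of a last vertex labelled \<open>r\<close>: it adopts
  \<open>s\<close> of \<open>l\<close> roots, chosen in \<open>l choose s\<close> ways, and leaves
  \<open>l - s + 1\<close> roots.\<close>

definition graft :: "nat \<Rightarrow> (nat \<Rightarrow> dpol) \<Rightarrow> nat \<Rightarrow> dpol" where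
  "graft r \<phi> l = (\<Sum>s\<le>l. of_nat (l choose s) * avar r (int s - 1) * \<phi> (l - s + 1))"

lemma word_sum_Nil: "word_sum \<phi> [] = \<phi> 0"
  by (simp add: word_sum_def forest_words_0 word_coeff_def)

text \<open>Summing over the last letter first absorbs it into the weight.\<close>

lemma word_sum_snoc: "word_sum \<phi> (xs @ [r]) = word_sum (graft r \<phi>) xs"
proof -
  let ?n = "length xs"
  define F where "F v = of_nat (word_coeff v) *
      (\<Prod>j=1..Suc ?n. avar ((xs @ [r]) ! (j - 1)) (int (v ! (j - 1)) - 1)) * \<phi> (Suc ?n - sum_list v)"
    for v
  have F: "F (w @ [s]) = of_nat (word_coeff w) *
      (\<Prod>j=1..?n. avar (xs ! (j - 1)) (int (w ! (j - 1)) - 1)) *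
      (of_nat ((?n - sum_list w) choose s) * avar r (int s - 1) * \<phi> (?n - sum_list w - s + 1))"
    if w: "w \<in> forest_words ?n" "s \<le> ?n - sum_list w" for w s
  proof -
    have l: "length w = ?n" "sum_list w + s \<le> ?n"
      using w forest_words_sum_le[OF w(1)] by (auto simp: forest_words_def)
    have "(\<Prod>j=1..?n. avar ((xs @ [r]) ! (j - 1)) (int ((w @ [s]) ! (j - 1)) - 1))
        = (\<Prod>j=1..?n. avar (xs ! (j - 1)) (int (w ! (j - 1)) - 1))"
      using l(1) by (intro prod.cong) (auto simp: nth_append)
    moreover have "Suc ?n - sum_list (w @ [s]) = ?n - sum_list w - s + 1" using l(2) by simp
    ultimately show ?thesis
      using l unfolding F_def
      by (simp add: word_coeff_append[OF l] nth_append ac_simps)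
  qed
  have "word_sum \<phi> (xs @ [r]) = sum F (forest_words (Suc ?n))"
    by (simp add: word_sum_def F_def)
  also have "\<dots> = (\<Sum>(w, s)\<in>(SIGMA w:forest_words ?n. {..?n - sum_list w}). F (w @ [s]))"
    by (subst sum.reindex_bij_betw[OF forest_words_Suc, symmetric]) (simp add: case_prod_beta)
  also have "\<dots> = (\<Sum>w\<in>forest_words ?n. \<Sum>s\<le>?n - sum_list w. F (w @ [s]))"
    by (subst sum.Sigma) (auto simp: finite_forest_words)
  also have "\<dots> = word_sum (graft r \<phi>) xs"
    unfolding word_sum_def graft_def sum_distrib_left
    by (intro sum.cong refl) (use F in auto)
  finally show ?thesis .
qed

text \<open>The indicator weight of one root selects the trees among the forests.\<close>

lemma block_sum_eq_word_sum:
  assumes "finite I" "I \<noteq> {}"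
  shows "block_sum I = word_sum (\<lambda>l. if l = 1 then 1 else 0) (sorted_list_of_set I)"
proof -
  have "card I \<ge> 1" using assms by (simp add: Suc_leI card_gt_0_iff)
  then show ?thesis
    unfolding block_sum_def word_sum_def words_eq[OF \<open>card I \<ge> 1\<close>] sorted_list_of_set.length_sorted_key_list_of_set
    by (subst sum.inter_filter[OF finite_forest_words]) (auto intro!: sum.cong)
qed

lemma sorted_list_of_set_insert_max:
  assumes "finite A" "\<And>x. x \<in> A \<Longrightarrow> x < M"
  shows "sorted_list_of_set (insert M A) = sorted_list_of_set A @ [M]"
proof -
  have "M \<notin> A" using assms(2) by blast
  moreover have "sorted_wrt (<) (sorted_list_of_set A @ [M])"
    using assms by (simp add: sorted_wrt_append)
  ultimately show ?thesis
    using assms(1) by (intro sorted_list_of_set_unique[THEN iffD1]) auto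
qed

text \<open>The maximum \<open>M\<close> is the last vertex. To leave a single root it must adopt
  all \<open>l\<close> roots, so \<open>graft\<close> of the indicator weight has only the term
  \<open>s = l\<close>, with coefficient 1.\<close>

lemma block_sum_insert_word_sum:
  assumes "finite C" "\<And>x. x \<in> C \<Longrightarrow> x < M"
  shows "block_sum (insert M C) = word_sum (\<lambda>l. avar M (int l - 1)) (sorted_list_of_set C)"
proof -
  have "graft M (\<lambda>l. if l = 1 then 1 else 0) l = avar M (int l - 1)" for l
  proof -
    have "graft M (\<lambda>l. if l = 1 then 1 else 0) l
        = (\<Sum>s\<le>l. if s = l then of_nat (l choose s) * avar M (int s - 1) else 0)"
      unfolding graft_def by (intro sum.cong) auto
    then show ?thesis by simp
  qed
  then have "graft M (\<lambda>l. if l = 1 then 1 else 0) = (\<lambda>l. avar M (int l - 1))" by (rule ext)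
  moreover have "block_sum (insert M C)
      = word_sum (\<lambda>l. if l = 1 then 1 else 0) (sorted_list_of_set C @ [M])"
    by (subst block_sum_eq_word_sum) (simp_all only: sorted_list_of_set_insert_max[OF assms] assms(1)
        finite_insert insert_not_empty not_False_eq_True)
  ultimately show ?thesis by (simp only: word_sum_snoc)
qed

section \<open>Grouping the vertices of a forest by its trees\<close>

definition part_sum :: "(nat \<Rightarrow> dpol) \<Rightarrow> nat set \<Rightarrow> dpol" where
  "part_sum \<phi> A = (\<Sum>P\<in>parts A. \<phi> (card P) * (\<Prod>D\<in>P. block_sum D))"

lemma sum_Pow_card:
  fixes g :: "nat \<Rightarrow> 'b::comm_semiring_1"
  assumes "finite P"
  shows "(\<Sum>Q\<in>Pow P. g (card Q)) = (\<Sum>s\<le>card P. of_nat (card P choose s) * g s)"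
proof -
  have "(\<Sum>Q\<in>Pow P. g (card Q)) = (\<Sum>s\<le>card P. \<Sum>Q\<in>{Q \<in> Pow P. card Q = s}. g (card Q))"
    using assms by (intro sum.group[symmetric]) (auto simp: card_mono)
  also have "\<dots> = (\<Sum>s\<le>card P. of_nat (card P choose s) * g s)"
  proof (rule sum.cong)
    fix s
    have "(\<Sum>Q\<in>{Q \<in> Pow P. card Q = s}. g (card Q)) = (\<Sum>Q\<in>{Q. Q \<subseteq> P \<and> card Q = s}. g s)"
      by (intro sum.cong) auto
    then show "(\<Sum>Q\<in>{Q \<in> Pow P. card Q = s}. g (card Q)) = of_nat (card P choose s) * g s"
      using assms by (simp add: n_subsets)
  qed simp
  finally show ?thesis .
qed

text \<open>Remove the maximal vertex \<open>M\<close>. The weight stays arbitrary because the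
  induction hypothesis is applied with two others: the variable of \<open>M\<close> on the subset
  \<open>C\<close> that shares a block with \<open>M\<close>, and \<open>graft M \<phi>\<close> on
  all of \<open>B\<close>.\<close>

lemma word_sum_eq_part_sum:
  assumes "finite A"
  shows "word_sum \<phi> (sorted_list_of_set A) = part_sum \<phi> A"
  using assms
proof (induction "card A" arbitrary: A \<phi> rule: less_induct)
  case less
  show ?case
  proof (cases "A = {}")
    case True
    then show ?thesis by (simp add: word_sum_Nil part_sum_def partition_on_empty)
  next
    case False
    define M where "M = Max A"
    define B where "B = A - {M}"
    have B: "finite B" "M \<notin> B" "\<And>x. x \<in> B \<Longrightarrow> x < M" "A = insert M B"
      using less.prems Max_in[OF less.prems False] by (auto simp: B_def M_def order.strict_iff_order)
    have IH: "word_sum \<psi> (sorted_list_of_set C) = part_sum \<psi> C" if "C \<subseteq> B" for C \<psi>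
    proof (rule less.hyps)
      show "finite C" using that B(1) finite_subset by blast
      show "card C < card A" using that B by (simp add: card_mono less_Suc_eq_le)
    qed
    have fin: "finite C" if "C \<subseteq> B" for C using that B(1) finite_subset by blast
    have ins: "card (insert (insert M C) R) = card R + 1"
        "(\<Prod>D\<in>insert (insert M C) R. block_sum D) = block_sum (insert M C) * (\<Prod>D\<in>R. block_sum D)"
      if "C \<subseteq> B" "partition_on (B - C) R" for C R
    proof -
      have "finite R" using that B(1) finite_elements by blast
      moreover have "insert M C \<notin> R" using that B(2) by (auto simp: partition_on_def)
      ultimately show "card (insert (insert M C) R) = card R + 1"
        "(\<Prod>D\<in>insert (insert M C) R. block_sum D) = block_sum (insert M C) * (\<Prod>D\<in>R. block_sum D)"
        by simp_all
    qed
    have "part_sum \<phi> A = (\<Sum>C\<in>Pow B. \<Sum>R\<in>parts (B - C).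
        block_sum (insert M C) * (\<phi> (card R + 1) * (\<Prod>D\<in>R. block_sum D)))"
      unfolding B(4) part_sum_def sum_parts_insert[OF B(1,2)]
      by (intro sum.cong) (auto simp: ins ac_simps)
    also have "\<dots> = (\<Sum>C\<in>Pow B. \<Sum>Q\<in>parts C. \<Sum>R\<in>parts (B - C).
        avar M (int (card Q) - 1) * (\<Prod>D\<in>Q. block_sum D) *
          (\<phi> (card R + 1) * (\<Prod>D\<in>R. block_sum D)))"
    proof (rule sum.cong)
      fix C assume "C \<in> Pow B"
      then have "block_sum (insert M C)
          = (\<Sum>Q\<in>parts C. avar M (int (card Q) - 1) * (\<Prod>D\<in>Q. block_sum D))"
        using B(3) fin by (subst block_sum_insert_word_sum) (auto simp: IH part_sum_def)
      then show "(\<Sum>R\<in>parts (B - C).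
          block_sum (insert M C) * (\<phi> (card R + 1) * (\<Prod>D\<in>R. block_sum D))) =
        (\<Sum>Q\<in>parts C. \<Sum>R\<in>parts (B - C). avar M (int (card Q) - 1) * (\<Prod>D\<in>Q. block_sum D) *
          (\<phi> (card R + 1) * (\<Prod>D\<in>R. block_sum D)))"
        by (simp only: sum_distrib_left[symmetric] sum_distrib_right[symmetric])
    qed simp
    \<comment> \<open>Read \<open>Q\<close> as the trees whose roots \<open>M\<close> adopts and
      \<open>R\<close> as the trees left alone; together they form a partition \<open>P\<close> of
      \<open>B\<close>.\<close>
    also have "\<dots> = (\<Sum>P\<in>parts B. \<Sum>Q\<in>Pow P.
        avar M (int (card Q) - 1) * (\<Prod>D\<in>Q. block_sum D) *
          (\<phi> (card (P - Q) + 1) * (\<Prod>D\<in>P - Q. block_sum D)))"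
      by (rule sum_parts_subset[OF B(1), symmetric])
    \<comment> \<open>The products over \<open>Q\<close> and \<open>P - Q\<close> merge into one
      over \<open>P\<close>, so the term depends on \<open>Q\<close> only through its size. Counting
      subsets by size gives the binomials of \<open>graft\<close>.\<close>
    also have "\<dots> = (\<Sum>P\<in>parts B. graft M \<phi> (card P) * (\<Prod>D\<in>P. block_sum D))"
    proof (rule sum.cong)
      fix P assume "P \<in> parts B"
      then have P: "finite P" using B(1) finite_elements by blast
      have "(\<Sum>Q\<in>Pow P. avar M (int (card Q) - 1) * (\<Prod>D\<in>Q. block_sum D) *
          (\<phi> (card (P - Q) + 1) * (\<Prod>D\<in>P - Q. block_sum D)))
        = (\<Sum>Q\<in>Pow P. avar M (int (card Q) - 1) * \<phi> (card P - card Q + 1) * (\<Prod>D\<in>P. block_sum D))"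
      proof (rule sum.cong)
        fix Q assume "Q \<in> Pow P"
        then have "card (P - Q) = card P - card Q"
          "(\<Prod>D\<in>P. block_sum D) = (\<Prod>D\<in>P - Q. block_sum D) * (\<Prod>D\<in>Q. block_sum D)"
          using P by (auto simp: card_Diff_subset finite_subset prod.subset_diff)
        then show "avar M (int (card Q) - 1) * (\<Prod>D\<in>Q. block_sum D) *
          (\<phi> (card (P - Q) + 1) * (\<Prod>D\<in>P - Q. block_sum D)) =
          avar M (int (card Q) - 1) * \<phi> (card P - card Q + 1) * (\<Prod>D\<in>P. block_sum D)"
          by (simp only: ac_simps)
      qed simp
      also have "\<dots> = graft M \<phi> (card P) * (\<Prod>D\<in>P. block_sum D)"
        unfolding graft_def sum_distrib_right[symmetric]
        by (subst sum_Pow_card[OF P, of "\<lambda>s. avar M (int s - 1) * \<phi> (card P - s + 1)"])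
           (simp add: mult.assoc)
      finally show "(\<Sum>Q\<in>Pow P. avar M (int (card Q) - 1) * (\<Prod>D\<in>Q. block_sum D) *
          (\<phi> (card (P - Q) + 1) * (\<Prod>D\<in>P - Q. block_sum D)))
        = graft M \<phi> (card P) * (\<Prod>D\<in>P. block_sum D)" .
    qed simp
    also have "\<dots> = word_sum (graft M \<phi>) (sorted_list_of_set B)"
      by (simp add: IH part_sum_def)
    also have "\<dots> = word_sum \<phi> (sorted_list_of_set A)"
      using sorted_list_of_set_insert_max[of B M] B(1,3) unfolding B(4) by (simp only: word_sum_snoc)
    finally show ?thesis ..
  qed
qed

section \<open>The block recursion in terms of braces\<close>

lemma der_pow_avar: "(der ^^ n) (avar r j) = avar r (j + int n)"
  by (induction n) (simp_all add: der_avar ac_simps)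

lemma brace_generator: "brace (generator r) v J = (\<Prod>j\<in>J. v j) * avar r (int (card J) - 1)"
  by (simp add: brace_def generator_def der_pow_avar)

text \<open>Differentiating the generator once per adopted tree raises its lower index from -1 to
  \<open>card Q - 1\<close>, exactly the variable that the word recursion assigns to
  \<open>M\<close>.\<close>

lemma block_sum_insert:
  assumes "finite C" "\<And>x. x \<in> C \<Longrightarrow> x < M"
  shows "block_sum (insert M C) = (\<Sum>Q\<in>parts C. brace (generator M) block_sum Q)"
  using assms
  by (simp add: block_sum_insert_word_sum word_sum_eq_part_sum part_sum_def brace_generator mult.commute)


section \<open>Products of generators\<close>

lemma sum_block_families_1:
  "(\<Sum>I\<in>block_families 1 m. f (I 0) (I 1)) = (\<Sum>S\<in>Pow {..<m}. f S ({..<m} - S))"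
\<comment> \<open>The second block is the complement of the first. The restriction to
  \<open>{..1}\<close> makes the family extensional, as \<open>block_families\<close>
  demands.\<close>
proof (rule sum.reindex_bij_witness[where i = "\<lambda>S. \<lambda>k\<in>{..1}. if k = 0 then S else {..<m} - S"
      and j = "\<lambda>I. I 0"], goal_cases)
  case (1 I)
  have at_most_1: "{..1} = {0, Suc 0}" by auto
  show ?case
  proof
    fix k
    show "(\<lambda>k\<in>{..1}. if k = 0 then I 0 else {..<m} - I 0) k = I k"
      using 1 unfolding block_families_def at_most_1
      by (auto simp: PiE_iff extensional_def disjoint_family_on_def)
  qed
next
  case (5 I)
  have at_most_1: "{..1} = {0, Suc 0}" by auto
  from 5 have "I 1 = {..<m} - I 0"
    unfolding block_families_def at_most_1 by (auto simp: disjoint_family_on_def)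
  then show ?case by simp
next
  case (4 S)
  have at_most_1: "{..1} = {0, Suc 0}" by auto
  show ?case using 4 unfolding block_families_def at_most_1
    by (auto simp: disjoint_family_on_def)
next
  case (2 I)
  then show ?case by (auto dest: block_familiesD(1))
next
  case (3 S)
  then show ?case by simp
qed

text \<open>With one left factor, a block family only decides which right factors are grafted onto
  \<open>u\<close>. \<open>star_formula\<close> speaks of lists, so \<open>P\<close> is enumerated
  and index sets are carried to subsets of \<open>P\<close>; indexing by \<open>P\<close> keeps
  equal values of \<open>z\<close> apart.\<close>

lemma sym_inj_star_prod:
  assumes "finite P"
  shows "sym_inj u \<star> (\<Prod>D\<in>P. sym_inj (z D))
    = (\<Sum>Q\<in>Pow P. sym_inj (brace u z Q) * (\<Prod>D\<in>P - Q. sym_inj (z D)))"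
proof -
  obtain Ds where Ds: "set Ds = P" "distinct Ds" using finite_distinct_list[OF assms] by blast
  let ?m = "length Ds"
  have bij: "bij_betw ((!) Ds) {..<?m} P" using Ds by (simp add: bij_betw_nth)
  then have inj: "inj_on ((!) Ds) {..<?m}" and im: "(!) Ds ` {..<?m} = P" by (auto simp: bij_betw_def)
  have "sym_inj u \<star> (\<Prod>D\<in>P. sym_inj (z D))
      = prod_list (map sym_inj [u]) \<star> prod_list (map sym_inj (map z Ds))"
    using prod.distinct_set_conv_list[OF Ds(2), of "\<lambda>D. sym_inj (z D)"] Ds(1)
    by (simp add: comp_def)
  also have "\<dots> = star_list [u] (map z Ds)" by (rule star_formula)
  also have "\<dots> = (\<Sum>I\<in>block_families 1 ?m. sym_inj (brace u ((!) (map z Ds)) (I 0)) *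
      (\<Prod>j\<in>I 1. sym_inj (map z Ds ! j)))"
    by (simp add: star_list_def)
  also have "\<dots> = (\<Sum>S\<in>Pow {..<?m}. sym_inj (brace u ((!) (map z Ds)) S) *
      (\<Prod>j\<in>{..<?m} - S. sym_inj (map z Ds ! j)))"
    by (rule sum_block_families_1)
  also have "\<dots> = (\<Sum>S\<in>Pow {..<?m}. sym_inj (brace u z ((!) Ds ` S)) *
      (\<Prod>D\<in>P - (!) Ds ` S. sym_inj (z D)))"
  proof (rule sum.cong)
    fix S assume S: "S \<in> Pow {..<?m}"
    have inj_S: "inj_on ((!) Ds) T" if "T \<subseteq> {..<?m}" for T using inj that by (rule inj_on_subset)
    have "P - (!) Ds ` S = (!) Ds ` ({..<?m} - S)"
      using inj im S by (simp add: inj_on_image_set_diff[OF inj])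
    moreover have "(\<Prod>D\<in>(!) Ds ` S. z D) = (\<Prod>j\<in>S. map z Ds ! j)"
      using S by (subst prod.reindex[OF inj_S]) (auto intro!: prod.cong)
    then have "brace u z ((!) Ds ` S) = brace u ((!) (map z Ds)) S"
      using S by (simp add: brace_def card_image[OF inj_S])
    moreover have "(\<Prod>D\<in>(!) Ds ` ({..<?m} - S). sym_inj (z D))
        = (\<Prod>j\<in>{..<?m} - S. sym_inj (map z Ds ! j))"
      by (subst prod.reindex[OF inj_S]) (auto intro!: prod.cong)
    ultimately show "sym_inj (brace u ((!) (map z Ds)) S) *
        (\<Prod>j\<in>{..<?m} - S. sym_inj (map z Ds ! j))
      = sym_inj (brace u z ((!) Ds ` S)) * (\<Prod>D\<in>P - (!) Ds ` S. sym_inj (z D))"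
      by simp
  qed simp
  also have "\<dots> = (\<Sum>Q\<in>Pow P. sym_inj (brace u z Q) * (\<Prod>D\<in>P - Q. sym_inj (z D)))"
    by (rule sum.reindex_bij_betw[OF bij_betw_Pow[OF bij],
          of "\<lambda>Q. sym_inj (brace u z Q) * (\<Prod>D\<in>P - Q. sym_inj (z D))"])
  finally show ?thesis .
qed

section \<open>Iterated left multiplication by generators\<close>

lemma star_one: "sym_inj u \<star> 1 = sym_inj u"
  using sym_inj_star_prod[of "{}" u] by (simp add: brace_def)

text \<open>The clause of \<open>star_prod\<close> for singletons needs \<open>star_one\<close>;
  with it, one recursion step covers every nonempty list.\<close>

lemma star_prod_Cons: "star_prod (sym_inj u # Ps) = sym_inj u \<star> star_prod Ps"
  by (cases Ps) (simp_all add: star_one)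

lemma lin_map_sum_distrib: "lin_map f \<Longrightarrow> f (\<Sum>x\<in>A. g x) = (\<Sum>x\<in>A. f (g x))"
  by (induction A rule: infinite_finite_induct) (auto simp: lin_map_zero, simp add: lin_map_def)

text \<open>Both sides become sums over \<open>C\<close>, \<open>Q\<close> and \<open>R\<close>:
  grafting chooses \<open>Q\<close> inside a partition, and \<open>block_sum_insert\<close>
  collapses the sum over \<open>Q\<close> to the block \<open>insert M C\<close>.\<close>

lemma generator_star_parts:
  assumes "finite A" "\<And>x. x \<in> A \<Longrightarrow> x < M"
  shows "sym_inj (generator M) \<star> (\<Sum>P\<in>parts A. \<Prod>D\<in>P. sym_inj (block_sum D))
    = (\<Sum>P\<in>parts (insert M A). \<Prod>D\<in>P. sym_inj (block_sum D))"
proof -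
  have "M \<notin> A" using assms(2) by blast
  have "sym_inj (generator M) \<star> (\<Sum>P\<in>parts A. \<Prod>D\<in>P. sym_inj (block_sum D))
      = (\<Sum>P\<in>parts A. sym_inj (generator M) \<star> (\<Prod>D\<in>P. sym_inj (block_sum D)))"
    by (rule lin_map_sum_distrib[OF lin_map_star_right])
  also have "\<dots> = (\<Sum>P\<in>parts A. \<Sum>Q\<in>Pow P.
      sym_inj (brace (generator M) block_sum Q) * (\<Prod>D\<in>P - Q. sym_inj (block_sum D)))"
    using assms(1) finite_elements by (intro sum.cong sym_inj_star_prod) blast+
  also have "\<dots> = (\<Sum>C\<in>Pow A. \<Sum>Q\<in>parts C. \<Sum>R\<in>parts (A - C).
      sym_inj (brace (generator M) block_sum Q) * (\<Prod>D\<in>R. sym_inj (block_sum D)))"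
    by (rule sum_parts_subset[OF assms(1)])
  also have "\<dots> = (\<Sum>C\<in>Pow A. \<Sum>R\<in>parts (A - C).
      \<Prod>D\<in>insert (insert M C) R. sym_inj (block_sum D))"
  proof (rule sum.cong)
    fix C assume C: "C \<in> Pow A"
    \<comment> \<open>Linearity of \<open>sym_inj\<close> transports the recursion from the
      polynomial algebra to the symmetric algebra.\<close>
    then have "sym_inj (block_sum (insert M C))
        = (\<Sum>Q\<in>parts C. sym_inj (brace (generator M) block_sum Q))"
      using assms finite_subset[of C A]
      by (subst block_sum_insert) (auto intro: lin_map_sum_distrib[OF lin_map_sym_inj])
    then have "(\<Sum>Q\<in>parts C. \<Sum>R\<in>parts (A - C).
        sym_inj (brace (generator M) block_sum Q) * (\<Prod>D\<in>R. sym_inj (block_sum D)))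
      = (\<Sum>R\<in>parts (A - C). sym_inj (block_sum (insert M C)) * (\<Prod>D\<in>R. sym_inj (block_sum D)))"
      by (simp only: sum_distrib_left[symmetric] sum_distrib_right[symmetric])
    also have "\<dots> = (\<Sum>R\<in>parts (A - C). \<Prod>D\<in>insert (insert M C) R. sym_inj (block_sum D))"
    proof (rule sum.cong)
      fix R assume R: "R \<in> parts (A - C)"
      then have "finite R" using assms(1) finite_elements by blast
      moreover have "insert M C \<notin> R" using R \<open>M \<notin> A\<close> by (auto simp: partition_on_def)
      ultimately show "sym_inj (block_sum (insert M C)) * (\<Prod>D\<in>R. sym_inj (block_sum D))
          = (\<Prod>D\<in>insert (insert M C) R. sym_inj (block_sum D))" by simp
    qed simp
    finally show "(\<Sum>Q\<in>parts C. \<Sum>R\<in>parts (A - C).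
        sym_inj (brace (generator M) block_sum Q) * (\<Prod>D\<in>R. sym_inj (block_sum D)))
      = (\<Sum>R\<in>parts (A - C). \<Prod>D\<in>insert (insert M C) R. sym_inj (block_sum D))" .
  qed simp
  also have "\<dots> = (\<Sum>P\<in>parts (insert M A). \<Prod>D\<in>P. sym_inj (block_sum D))"
    by (rule sum_parts_insert[OF assms(1) \<open>M \<notin> A\<close>, symmetric])
  finally show ?thesis .
qed

text \<open>The reversed list puts the largest generator leftmost, so each induction step multiplies
  by a generator whose label exceeds all earlier ones. For \<open>n = 0\<close> both sides are
  1.\<close>

lemma star_prod_generators:
  "star_prod (map (\<lambda>r. sym_inj (generator r)) (rev [1..<n + 1]))
    = (\<Sum>P\<in>parts {1..n}. \<Prod>D\<in>P. sym_inj (block_sum D))"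
proof (induction n)
  case (Suc n)
  have "star_prod (map (\<lambda>r. sym_inj (generator r)) (rev [1..<Suc n + 1]))
      = sym_inj (generator (Suc n)) \<star> (\<Sum>P\<in>parts {1..n}. \<Prod>D\<in>P. sym_inj (block_sum D))"
    using Suc by (simp add: star_prod_Cons)
  also have "\<dots> = (\<Sum>P\<in>parts (insert (Suc n) {1..n}). \<Prod>D\<in>P. sym_inj (block_sum D))"
    by (rule generator_star_parts) auto
  also have "insert (Suc n) {1..n} = {1..Suc n}" by auto
  finally show ?case .
qed (simp add: partition_on_empty)

lemma star_prod_generators_closed:
  "n \<le> i \<Longrightarrow> star_prod (map (\<lambda>r. sym_inj (generator r)) (rev [1..<n + 1])) \<in> sym_novikov i"
proof (induction n)
  case (Suc n)
  then show ?case
    by (simp add: star_prod_Cons star_closed sym_inj_closed generator_in_novikov)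
qed (simp add: sym_novikov_one)

theorem theorem5p3:
  fixes i :: nat
  assumes "i \<ge> 1"
  shows "star_prod (map (\<lambda>r. sym_inj (generator r)) (rev [1..<i + 1])) \<in> sym_novikov i \<and>
    star_prod (map (\<lambda>r. sym_inj (generator r)) (rev [1..<i + 1])) =
      (\<Sum>k=1..i. \<Sum>Is\<in>ordered_partitions i k. \<Prod>j<k. sym_inj (block_sum (Is ! j)))"
  using star_prod_generators_closed[of i i] star_prod_generators[of i]
    sum_ordered_partitions[OF assms, of "\<lambda>D. sym_inj (block_sum D)"]
  by simp

end
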